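(* Let $f:[0,\infty)\to\mathbb{R}$ be convex with $f(1)=0$. Let $\rho,\sigma$ be quantum states on a Hilbert space of finite dimension $n$, with $\sigma$ invertible, and define $$D_f^{\max}(\rho\|\sigma)=\operatorname{Tr}\bigl(\sigma^{1/2} f(\sigma^{-1/2}\rho\,\sigma^{-1/2})\,\sigma^{1/2}\bigr).$$ Then for every quantum $f$-divergence $D_f(\cdot\|\cdot)$, $$D_f(\rho\|\sigma)\le D_f^{\max}(\rho\|\sigma).$$ Furthermore, there exist classical probability distributions $r=(r_1,\dots,r_n)$ and $s=(s_1,\dots,s_n)$, depending only on $\rho,\sigma$ (and not on $f$), such that $$D_f^{\max}(\rho\|\sigma)=D_f(r\|s).$$ Explicitly, if $\sigma^{-1/2}\rho\,\sigma^{-1/2}=\sum_{i=1}^n\lambda_i|u_i\rangle\langle u_i|$ is a spectral decomposition with eigenvalues $\lambda_i\ge 0$ and orthonormal eigenvectors $|u_i\rangle$, one may take $s_i=\langle u_i|\sigma|u_i\rangle>0$ and $r_i=\lambda_i s_i\ge 0$ for $i=1,\dots,n$.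
   Context: A quantum state is a positive semidefinite operator of trace $1$ on a finite-dimensional complex Hilbert space. A quantum channel is a completely positive trace-preserving linear map. For a Hermitian positive semidefinite $X$, $f(X)$ is defined by functional calculus. Classical $f$-divergence: for probability distributions $p=(p_1,\dots,p_n)$, $q=(q_1,\dots,q_n)$, $D_f(p\|q)=\sum_{i} q_i\, f(p_i/q_i)$ (with the usual conventions for terms with $q_i=0$: $0f(0/0)=0$ and $0f(a/0)=a\lim_{x\to\infty}f(x)/x$ for $a>0$). Quantum $f$-divergence: any function $D_f(\rho\|\sigma)\in[0,\infty]$ of pairs of quantum states on a common finite-dimensional Hilbert space such that (i) if $\rho\sigma=\sigma\rho$, then $D_f(\rho\|\sigma)=D_f(p\|q)$, where $p$ and $q$ are the eigenvalues of $\rho$ and $\sigma$ listed along a common orthonormal eigenbasis; and (ii) $D_f(\mathcal{W}(\rho)\|\mathcal{W}(\sigma))\le D_f(\rho\|\sigma)$ for every quantum channel $\mathcal{W}$. *)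

theory Defs
  imports
    "HOL-Library.Extended_Real"
    "HOL-Analysis.Convex"
    "Jordan_Normal_Form.Schur_Decomposition"
begin

text \<open>
  A Hilbert space of dimension \<open>n\<close> is \<open>\<complex>\<^sup>n\<close>, with operators in \<open>carrier_mat n n\<close>. The inner
  product \<open>v \<bullet>c w\<close> is linear in \<open>v\<close> and conjugate-linear in \<open>w\<close>, so that \<open>\<langle>w|A|v\<rangle>\<close> is
  \<open>(A *\<^sub>v v) \<bullet>c w\<close>. Families indexed by \<open>1, \<dots>, n\<close> are functions on \<open>nat\<close> of which only the
  values at \<open>i < n\<close> matter.
\<close>

definition mat_trace :: "complex mat \<Rightarrow> complex" where
  "mat_trace A = (\<Sum>i<dim_row A. A $$ (i, i))"

definition psd :: "nat \<Rightarrow> complex mat \<Rightarrow> bool" where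
  "psd n A \<longleftrightarrow> A \<in> carrier_mat n n \<and> mat_adjoint A = A
     \<and> (\<forall>v\<in>carrier_vec n. 0 \<le> Re ((A *\<^sub>v v) \<bullet>c v))"

definition quantum_state :: "nat \<Rightarrow> complex mat \<Rightarrow> bool" where
  "quantum_state n \<rho> \<longleftrightarrow> psd n \<rho> \<and> mat_trace \<rho> = 1"

text \<open>
  The map \<open>id\<^sub>k \<otimes> W\<close>. Elements of \<open>M\<^sub>k(\<complex>) \<otimes> M\<^sub>n(\<complex>)\<close> are \<open>k \<times> k\<close> block matrices with blocks of
  size \<open>n \<times> n\<close>, and \<open>W\<close>, which maps \<open>n \<times> n\<close> to \<open>m \<times> m\<close> matrices, acts on each block.
\<close>

definition mat_block :: "nat \<Rightarrow> complex mat \<Rightarrow> nat \<Rightarrow> nat \<Rightarrow> complex mat" where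
  "mat_block n A a b = mat n n (\<lambda>(i, j). A $$ (a * n + i, b * n + j))"

definition ampliation ::
  "nat \<Rightarrow> nat \<Rightarrow> nat \<Rightarrow> (complex mat \<Rightarrow> complex mat) \<Rightarrow> complex mat \<Rightarrow> complex mat" where
  "ampliation k n m W A =
     mat (k * m) (k * m)
       (\<lambda>(i, j). W (mat_block n A (i div m) (j div m)) $$ (i mod m, j mod m))"

definition quantum_channel :: "nat \<Rightarrow> nat \<Rightarrow> (complex mat \<Rightarrow> complex mat) \<Rightarrow> bool" where
  "quantum_channel n m W \<longleftrightarrow>
     (\<forall>A\<in>carrier_mat n n. W A \<in> carrier_mat m m) \<and>
     (\<forall>A\<in>carrier_mat n n. \<forall>B\<in>carrier_mat n n. W (A + B) = W A + W B) \<and>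
     (\<forall>c. \<forall>A\<in>carrier_mat n n. W (c \<cdot>\<^sub>m A) = c \<cdot>\<^sub>m W A) \<and>
     (\<forall>k A. psd (k * n) A \<longrightarrow> psd (k * m) (ampliation k n m W A)) \<and>
     (\<forall>A\<in>carrier_mat n n. mat_trace (W A) = mat_trace A)"

definition orthonormal_basis :: "nat \<Rightarrow> (nat \<Rightarrow> complex vec) \<Rightarrow> bool" where
  "orthonormal_basis n u \<longleftrightarrow>
     (\<forall>i<n. u i \<in> carrier_vec n) \<and>
     (\<forall>i<n. \<forall>j<n. u i \<bullet>c u j = (if i = j then 1 else 0))"

text \<open>The operator \<open>\<Sum>\<^sub>i \<lambda>\<^sub>i |u\<^sub>i\<rangle>\<langle>u\<^sub>i|\<close>.\<close>

definition spectral_sum :: "nat \<Rightarrow> (nat \<Rightarrow> real) \<Rightarrow> (nat \<Rightarrow> complex vec) \<Rightarrow> complex mat" where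
  "spectral_sum n lam u =
     mat n n (\<lambda>(i, j). \<Sum>k<n. complex_of_real (lam k) * (u k $ i) * cnj (u k $ j))"

definition spectral_decomposition ::
  "nat \<Rightarrow> complex mat \<Rightarrow> (nat \<Rightarrow> real) \<Rightarrow> (nat \<Rightarrow> complex vec) \<Rightarrow> bool" where
  "spectral_decomposition n X lam u \<longleftrightarrow> orthonormal_basis n u \<and> X = spectral_sum n lam u"

text \<open>
  Functional calculus for Hermitian \<open>X\<close>; the result does not depend on the choice of the
  spectral decomposition.
\<close>

definition fun_calc :: "(real \<Rightarrow> real) \<Rightarrow> complex mat \<Rightarrow> complex mat" where
  "fun_calc f X = (THE Y. \<exists>lam u. spectral_decomposition (dim_row X) X lam u
                                \<and> Y = spectral_sum (dim_row X) (\<lambda>i. f (lam i)) u)"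

definition mat_sqrt :: "complex mat \<Rightarrow> complex mat" where
  "mat_sqrt X = fun_calc sqrt X"

definition mat_inv_sqrt :: "complex mat \<Rightarrow> complex mat" where
  "mat_inv_sqrt X = fun_calc (\<lambda>x. 1 / sqrt x) X"

definition prob_dist :: "nat \<Rightarrow> (nat \<Rightarrow> real) \<Rightarrow> bool" where
  "prob_dist n p \<longleftrightarrow> (\<forall>i<n. 0 \<le> p i) \<and> (\<Sum>i<n. p i) = 1"

text \<open>
  A function \<open>f\<close> on the half-line \<open>[0, \<infinity>)\<close> is a function on the reals whose values at negative
  arguments are never used. The limit of \<open>f x / x\<close> exists in \<open>(-\<infinity>, \<infinity>]\<close> for convex \<open>f\<close>.
\<close>

definition classical_f_divergence ::
  "(real \<Rightarrow> real) \<Rightarrow> nat \<Rightarrow> (nat \<Rightarrow> real) \<Rightarrow> (nat \<Rightarrow> real) \<Rightarrow> ereal" where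
  "classical_f_divergence f n p q =
     (\<Sum>i<n. if q i = 0
             then (if p i = 0 then 0 else ereal (p i) * Lim at_top (\<lambda>x. ereal (f x / x)))
             else ereal (q i * f (p i / q i)))"

text \<open>
  A quantum divergence is one function on pairs of states of all dimensions; the dimension is
  carried by the matrices, and values at other arguments are unconstrained.
\<close>

definition quantum_f_divergence ::
  "(real \<Rightarrow> real) \<Rightarrow> (complex mat \<Rightarrow> complex mat \<Rightarrow> ereal) \<Rightarrow> bool" where
  "quantum_f_divergence f D \<longleftrightarrow>
     (\<forall>n \<rho> \<sigma>. quantum_state n \<rho> \<longrightarrow> quantum_state n \<sigma> \<longrightarrow> 0 \<le> D \<rho> \<sigma>) \<and>
     (\<forall>n \<rho> \<sigma> p q u.
        quantum_state n \<rho> \<longrightarrow> quantum_state n \<sigma> \<longrightarrow> \<rho> * \<sigma> = \<sigma> * \<rho> \<longrightarrow>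
        orthonormal_basis n u \<longrightarrow>
        (\<forall>i<n. \<rho> *\<^sub>v u i = complex_of_real (p i) \<cdot>\<^sub>v u i) \<longrightarrow>
        (\<forall>i<n. \<sigma> *\<^sub>v u i = complex_of_real (q i) \<cdot>\<^sub>v u i) \<longrightarrow>
        D \<rho> \<sigma> = classical_f_divergence f n p q) \<and>
     (\<forall>n m W \<rho> \<sigma>.
        quantum_channel n m W \<longrightarrow> quantum_state n \<rho> \<longrightarrow> quantum_state n \<sigma> \<longrightarrow>
        D (W \<rho>) (W \<sigma>) \<le> D \<rho> \<sigma>)"

definition max_f_divergence ::
  "(real \<Rightarrow> real) \<Rightarrow> complex mat \<Rightarrow> complex mat \<Rightarrow> complex" where
  "max_f_divergence f \<rho> \<sigma> =
     mat_trace (mat_sqrt \<sigma> * fun_calc f (mat_inv_sqrt \<sigma> * \<rho> * mat_inv_sqrt \<sigma>) * mat_sqrt \<sigma>)"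

end

theory Submission
  imports Defs "Jordan_Normal_Form.Spectral_Radius"
begin

text \<open>
  Let \<open>\<sigma>\<^sup>-\<^sup>1\<^sup>/\<^sup>2 \<rho> \<sigma>\<^sup>-\<^sup>1\<^sup>/\<^sup>2 = V diag(\<lambda>) V\<^sup>*\<close>, put \<open>P = \<sigma>\<^sup>1\<^sup>/\<^sup>2 V\<close> and let \<open>s\<^sub>i > 0\<close> be the squared
  norm of the \<open>i\<close>-th column of \<open>P\<close>. Measuring in the standard basis and preparing the normalised
  \<open>i\<close>-th column of \<open>P\<close> on outcome \<open>i\<close> is a channel. It maps the commuting states \<open>diag(\<lambda> s)\<close> and
  \<open>diag(s)\<close> to \<open>P diag(\<lambda>) P\<^sup>* = \<rho>\<close> and \<open>P P\<^sup>* = \<sigma>\<close>, so monotonicity bounds every quantum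
  \<open>f\<close>-divergence by the classical one of \<open>(\<lambda> s, s)\<close>. That one is
  \<open>\<Sum>\<^sub>i s\<^sub>i f(\<lambda>\<^sub>i) = Tr (P diag(f(\<lambda>)) P\<^sup>*)\<close>, the maximal \<open>f\<close>-divergence.
\<close>

subsection \<open>Matrices, adjoints and spectral sums\<close>

lemma mat_adjoint_carrier [simp]:
  "A \<in> carrier_mat n m \<Longrightarrow> mat_adjoint A \<in> carrier_mat m n"
  by (auto simp: mat_adjoint_def mat_of_rows_def)

lemma mat_adjoint_dim [simp]:
  "dim_row (mat_adjoint A) = dim_col A" "dim_col (mat_adjoint A) = dim_row A"
  by (auto simp: mat_adjoint_def mat_of_rows_def)

lemma mat_adjoint_index [simp]:
  fixes A :: "complex mat"
  assumes "i < dim_col A" "j < dim_row A"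
  shows "mat_adjoint A $$ (i, j) = cnj (A $$ (j, i))"
  using assms by (simp add: mat_adjoint_def mat_of_rows_def conjugate_complex_def)

lemma mult_mat_index:
  assumes "A \<in> carrier_mat n k" "B \<in> carrier_mat k m" "i < n" "j < m"
  shows "(A * B) $$ (i, j) = (\<Sum>l<k. A $$ (i, l) * B $$ (l, j))"
  using assms by (simp add: scalar_prod_def lessThan_atLeast0)

lemma mult_mat_vec_index:
  assumes "A \<in> carrier_mat n k" "v \<in> carrier_vec k" "i < n"
  shows "(A *\<^sub>v v) $ i = (\<Sum>l<k. A $$ (i, l) * v $ l)"
  using assms by (simp add: scalar_prod_def lessThan_atLeast0)

lemma cscalar_prod_sum:
  fixes v w :: "complex vec"
  assumes "v \<in> carrier_vec n" "w \<in> carrier_vec n"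
  shows "v \<bullet>c w = (\<Sum>l<n. v $ l * cnj (w $ l))"
  using assms by (simp add: scalar_prod_def lessThan_atLeast0 conjugate_complex_def)

lemma mat_adjoint_mult:
  fixes A B :: "complex mat"
  assumes "A \<in> carrier_mat n k" "B \<in> carrier_mat k m"
  shows "mat_adjoint (A * B) = mat_adjoint B * mat_adjoint A"
proof (rule eq_matI, goal_cases)
  case (1 i j)
  then have ij: "i < m" "j < n" using assms by auto
  have "mat_adjoint (A * B) $$ (i, j) = cnj ((A * B) $$ (j, i))"
    using assms ij by (subst mat_adjoint_index) auto
  also have "\<dots> = (\<Sum>l<k. mat_adjoint B $$ (i, l) * mat_adjoint A $$ (l, j))"
    unfolding mult_mat_index[OF assms ij(2,1)] cnj_sum
    using assms ij by (intro sum.cong) auto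
  also have "\<dots> = (mat_adjoint B * mat_adjoint A) $$ (i, j)"
    using assms ij by (subst mult_mat_index[of _ m k _ n]) auto
  finally show ?case .
qed (use assms in auto)

lemma mat_adjoint_adjoint [simp]: "mat_adjoint (mat_adjoint A) = (A :: complex mat)"
  by (rule eq_matI) auto

lemma cscalar_prod_adjoint:
  fixes A :: "complex mat"
  assumes "A \<in> carrier_mat n m" "v \<in> carrier_vec m" "w \<in> carrier_vec n"
  shows "(A *\<^sub>v v) \<bullet>c w = v \<bullet>c (mat_adjoint A *\<^sub>v w)"
proof -
  have "(A *\<^sub>v v) \<bullet>c w = (\<Sum>i<n. \<Sum>j<m. A $$ (i, j) * v $ j * cnj (w $ i))"
    using assms
    by (subst cscalar_prod_sum[of _ n])
      (auto simp: mult_mat_vec_index sum_distrib_right simp del: index_mult_mat_vec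
        intro!: sum.cong)
  also have "\<dots> = (\<Sum>j<m. \<Sum>i<n. A $$ (i, j) * v $ j * cnj (w $ i))"
    by (rule sum.swap)
  also have "\<dots> = v \<bullet>c (mat_adjoint A *\<^sub>v w)"
    using assms
    by (subst cscalar_prod_sum[of _ m])
      (auto simp: mult_mat_vec_index[of _ m n] sum_distrib_left mult_ac
        simp del: index_mult_mat_vec intro!: sum.cong intro: mult_mat_vec_carrier[of _ m n])
  finally show ?thesis .
qed

section \<open>Diagonal matrices and matrices with prescribed columns\<close>

definition real_diag :: "nat \<Rightarrow> (nat \<Rightarrow> real) \<Rightarrow> complex mat" where
  "real_diag n c = mat n n (\<lambda>(i, j). if i = j then complex_of_real (c i) else 0)"

text \<open>Packing the vectors as columns turns statements about a family into matrix identities: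
  with \<open>U = basis_mat n u\<close>, orthonormality reads
  \<open>mat_adjoint U * U = 1\<^sub>m n\<close> and a spectral sum becomes
  \<open>U * real_diag n c * mat_adjoint U\<close>.\<close>

definition basis_mat :: "nat \<Rightarrow> (nat \<Rightarrow> complex vec) \<Rightarrow> complex mat" where
  "basis_mat n u = mat n n (\<lambda>(i, j). u j $ i)"

lemma real_diag_carrier [simp]: "real_diag n c \<in> carrier_mat n n"
  by (simp add: real_diag_def)

lemma basis_mat_carrier [simp]: "basis_mat n u \<in> carrier_mat n n"
  by (simp add: basis_mat_def)

lemma basis_mat_dim [simp]: "dim_row (basis_mat n u) = n" "dim_col (basis_mat n u) = n"
  by (simp_all add: basis_mat_def)

lemma real_diag_dim [simp]: "dim_row (real_diag n u) = n" "dim_col (real_diag n u) = n"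
  by (simp_all add: real_diag_def)

lemma mult_real_diag_index:
  assumes "A \<in> carrier_mat m n" "i < m" "j < n"
  shows "(A * real_diag n c) $$ (i, j) = A $$ (i, j) * complex_of_real (c j)"
  using assms
  by (subst mult_mat_index[of _ m n _ n])
    (auto simp: real_diag_def if_distrib[of "\<lambda>x. _ * x"] cong: if_cong)

lemma real_diag_mult_index:
  assumes "A \<in> carrier_mat n m" "i < n" "j < m"
  shows "(real_diag n c * A) $$ (i, j) = complex_of_real (c i) * A $$ (i, j)"
  using assms
  by (subst mult_mat_index[of _ n n _ m])
    (auto simp: real_diag_def if_distrib[of "\<lambda>x. x * _"] cong: if_cong)

lemma real_diag_mult: "real_diag n a * real_diag n b = real_diag n (\<lambda>i. a i * b i)"
  by (rule eq_matI)
    (simp_all add: mult_real_diag_index[of _ n] del: index_mult_mat(1), simp_all add: real_diag_def)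

lemma real_diag_adjoint [simp]: "mat_adjoint (real_diag n c) = real_diag n c"
  by (rule eq_matI) (auto simp: real_diag_def)

lemma real_diag_one: "(\<And>i. i < n \<Longrightarrow> c i = 1) \<Longrightarrow> real_diag n c = 1\<^sub>m n"
  by (rule eq_matI) (auto simp: real_diag_def)

lemma mult_basis_mat_index:
  assumes "A \<in> carrier_mat n n" "i < n" "j < n" "u j \<in> carrier_vec n"
  shows "(A * basis_mat n u) $$ (i, j) = (A *\<^sub>v u j) $ i"
  using assms
  by (auto simp: mult_mat_index[of _ n n _ n] mult_mat_vec_index basis_mat_def
      simp del: index_mult_mat_vec index_mult_mat(1) intro!: sum.cong)

text \<open>Identifies the congruence with the matrix of the sesquilinear form of \<open>A\<close>
  on the vectors \<open>u\<close>. It serves for Gram matrices (\<open>A\<close> the identity), for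
  the change of basis in the spectral theorem, and for the diagonal values that give eigenvalues and
  column norms.\<close>

lemma basis_mat_congruence_index:
  assumes "A \<in> carrier_mat n n" "i < n" "j < n" "u i \<in> carrier_vec n" "u j \<in> carrier_vec n"
  shows "(mat_adjoint (basis_mat n u) * A * basis_mat n u) $$ (i, j) = (A *\<^sub>v u j) \<bullet>c u i"
proof -
  have "(mat_adjoint (basis_mat n u) * (A * basis_mat n u)) $$ (i, j)
      = (\<Sum>k<n. cnj (u i $ k) * (A *\<^sub>v u j) $ k)"
    using assms
    by (subst mult_mat_index[of _ n n _ n])
      (auto simp: mult_basis_mat_index simp del: index_mult_mat_vec index_mult_mat(1)
        intro!: sum.cong, simp add: basis_mat_def)
  also have "\<dots> = (A *\<^sub>v u j) \<bullet>c u i"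
    using assms by (subst cscalar_prod_sum[of _ n]) (auto simp: mult.commute)
  also have "mat_adjoint (basis_mat n u) * (A * basis_mat n u)
      = mat_adjoint (basis_mat n u) * A * basis_mat n u"
    using assms by (intro assoc_mult_mat[symmetric, of _ n n _ n _ n]) auto
  finally show ?thesis .
qed

lemma orthonormal_basis_iff:
  "orthonormal_basis n u \<longleftrightarrow>
     (\<forall>i<n. u i \<in> carrier_vec n) \<and> mat_adjoint (basis_mat n u) * basis_mat n u = 1\<^sub>m n"
proof -
  have "mat_adjoint (basis_mat n u) * basis_mat n u = 1\<^sub>m n \<longleftrightarrow>
      (\<forall>i<n. \<forall>j<n. u i \<bullet>c u j = (if i = j then 1 else 0))"
    if u: "\<forall>i<n. u i \<in> carrier_vec n"
  proof -
    have *: "(mat_adjoint (basis_mat n u) * basis_mat n u) $$ (i, j) = u j \<bullet>c u i"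
      if "i < n" "j < n" for i j
      using basis_mat_congruence_index[of "1\<^sub>m n" n i j u] u that
      by (simp add: right_mult_one_mat[of _ n n])
    show ?thesis
      using * by (auto simp: mat_eq_iff simp del: index_mult_mat(1))
  qed
  then show ?thesis unfolding orthonormal_basis_def by blast
qed

lemma orthonormal_basis_unitary:
  assumes "orthonormal_basis n u"
  shows "mat_adjoint (basis_mat n u) * basis_mat n u = 1\<^sub>m n"
    and "basis_mat n u * mat_adjoint (basis_mat n u) = 1\<^sub>m n"
proof -
  show 1: "mat_adjoint (basis_mat n u) * basis_mat n u = 1\<^sub>m n"
    using assms by (simp add: orthonormal_basis_iff)
  show "basis_mat n u * mat_adjoint (basis_mat n u) = 1\<^sub>m n"
    \<comment> \<open>For square matrices a left inverse is also a right inverse, so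
      \<open>n\<close> orthonormal vectors are automatically complete.\<close>
    by (rule mat_mult_left_right_inverse[OF _ _ 1]) auto
qed

lemma spectral_sum_eq:
  "spectral_sum n c u = basis_mat n u * real_diag n c * mat_adjoint (basis_mat n u)"
proof (rule eq_matI, goal_cases)
  case (1 i j)
  then have ij: "i < n" "j < n" by auto
  have "(basis_mat n u * real_diag n c * mat_adjoint (basis_mat n u)) $$ (i, j)
      = (\<Sum>k<n. (basis_mat n u * real_diag n c) $$ (i, k) * mat_adjoint (basis_mat n u) $$ (k, j))"
    using ij by (intro mult_mat_index[of _ n n _ n]) (auto intro: mult_carrier_mat[of _ n n])
  also have "\<dots> = (\<Sum>k<n. complex_of_real (c k) * u k $ i * cnj (u k $ j))"
    using ij
    by (intro sum.cong) (auto simp: mult_real_diag_index[of _ n] simp del: index_mult_mat(1),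
        auto simp: basis_mat_def)
  finally show ?case using ij by (simp add: spectral_sum_def)
qed (auto simp: spectral_sum_def)

subsection \<open>Spectral theorem and functional calculus\<close>

text \<open>Once products are nested to the right, a cancelling pair is hidden inside
  \<open>A * (B * C)\<close>; as a rewrite rule this exposes and removes it.\<close>

lemma mult_mat_cancel_left:
  fixes A B :: "complex mat"
  assumes "A * B = 1\<^sub>m n" "A \<in> carrier_mat n n" "B \<in> carrier_mat n n" "C \<in> carrier_mat n n"
  shows "A * (B * C) = C"
  using assms assoc_mult_mat[of A n n B n C n] by simp

lemma basis_mat_col: "U \<in> carrier_mat n n \<Longrightarrow> basis_mat n (col U) = U"
  by (rule eq_matI) (auto simp: basis_mat_def)

lemma spectral_decomposition_of_unitary:
  assumes U: "U \<in> carrier_mat n n" "mat_adjoint U * U = 1\<^sub>m n"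
  shows "spectral_decomposition n (U * real_diag n c * mat_adjoint U) c (col U)"
  using U unfolding spectral_decomposition_def orthonormal_basis_iff spectral_sum_eq
  by (auto simp: basis_mat_col)

lemma cscalar_prod_self:
  fixes v :: "complex vec"
  assumes "v \<in> carrier_vec n"
  shows "v \<bullet>c v = complex_of_real (\<Sum>l<n. (cmod (v $ l))\<^sup>2)"
  using assms by (simp add: cscalar_prod_sum complex_norm_square[symmetric])

text \<open>Complete \<open>v\<close> to a basis, orthogonalise, and normalise. Gram-Schmidt keeps
  the first vector, so \<open>w 0\<close> differs from \<open>v\<close> only by the normalising
  factor.\<close>

lemma orthonormal_basis_extend:
  assumes v: "v \<in> carrier_vec n" "v \<noteq> 0\<^sub>v n"
  shows "\<exists>w c. orthonormal_basis n w \<and> w 0 = c \<cdot>\<^sub>v v"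
proof -
  interpret cof_vec_space n "TYPE(complex)" .
  define b where "b = basis_completion v"
  define ws where "ws = gram_schmidt n b"
  from basis_completion[OF v, folded b_def]
  have b: "distinct b" "\<not> lin_dep (set b)" "set b \<subseteq> carrier_vec n" "hd b = v" "length b = n"
    by auto
  from gram_schmidt_result[OF b(3,1,2) refl, folded ws_def]
  have ws: "set ws \<subseteq> carrier_vec n" "corthogonal ws" "length ws = n"
    using b(5) by auto
  \<comment> \<open>In dimension zero the only vector is zero; hence the list has a head to speak
    of.\<close>
  have n: "n \<noteq> 0" using v by auto
  with b obtain vs where "b = v # vs" by (cases b) auto
  then have hd_ws: "ws ! 0 = v"
    using gram_schmidt_hd[OF v(1), of vs] ws(3) n unfolding ws_def
    by (metis hd_conv_nth list.size(3))
  define N where "N i = sqrt (\<Sum>l<n. (cmod (ws ! i $ l))\<^sup>2)" for i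
  define w where "w i = (1 / complex_of_real (N i)) \<cdot>\<^sub>v ws ! i" for i
  have wsc: "ws ! i \<in> carrier_vec n" if "i < n" for i
    using ws that by (metis nth_mem subsetD)
  have self: "ws ! i \<bullet>c ws ! i = complex_of_real (N i) * complex_of_real (N i)" if "i < n" for i
    using cscalar_prod_self[OF wsc[OF that]]
    by (simp add: N_def flip: of_real_mult) (simp add: sum_nonneg)
  have N: "N i \<noteq> 0" if "i < n" for i
    using corthogonalD[OF ws(2), of i i] self[OF that] that ws(3) by auto
  have "w i \<bullet>c w j = (if i = j then 1 else 0)" if "i < n" "j < n" for i j
  proof -
    have "w i \<bullet>c w j = (ws ! i \<bullet>c ws ! j) / (complex_of_real (N i) * complex_of_real (N j))"
      using wsc[OF that(1)] wsc[OF that(2)]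
      by (simp add: w_def conjugate_smult_vec conjugate_complex_def)
    then show ?thesis
      using corthogonalD[OF ws(2), of i j] self[OF that(1)] N that ws(3) by auto
  qed
  then have "orthonormal_basis n w"
    unfolding orthonormal_basis_def w_def using wsc by auto
  then show ?thesis using w_def hd_ws by metis
qed

lemma unit_vec_cscalar_prod_vCons:
  assumes "x \<in> carrier_vec n"
  shows "unit_vec (Suc n) 0 \<bullet>c vCons 0 x = (0 :: complex)"
    and "vCons 0 x \<bullet>c unit_vec (Suc n) 0 = (0 :: complex)"
  using assms
  by (simp_all add: cscalar_prod_sum[of _ "Suc n"] sum.lessThan_Suc_shift)

text \<open>Induction by deflation. In an orthonormal basis starting with an eigenvector, a
  Hermitian matrix splits into a real corner entry and a Hermitian block of size \<open>n\<close>;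
  the induction hypothesis diagonalises the block, and the two changes of basis are
  composed.\<close>

lemma hermitian_spectral_decomposition:
  assumes "A \<in> carrier_mat n n" "mat_adjoint A = A"
  shows "\<exists>lam u. spectral_decomposition n A lam u"
  using assms
proof (induction n arbitrary: A)
  case 0
  then show ?case
    by (auto simp: spectral_decomposition_def orthonormal_basis_def spectral_sum_def mat_eq_iff)
next
  case (Suc n)
  let ?N = "Suc n"
  note A = Suc.prems(1) and herm = Suc.prems(2)
  note assoc = assoc_mult_mat[of _ ?N ?N _ ?N _ ?N]
  note carr = mult_carrier_mat[of _ ?N ?N _ ?N]
  \<comment> \<open>An eigenvalue exists because the field is algebraically closed and the size
    \<open>Suc n\<close> is positive.\<close>
  from spectrum_non_empty[OF A] obtain e where "eigenvalue A e"
    unfolding spectrum_def by auto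
  then obtain v where v: "v \<in> carrier_vec ?N" "v \<noteq> 0\<^sub>v ?N" "A *\<^sub>v v = e \<cdot>\<^sub>v v"
    using A unfolding eigenvalue_def eigenvector_def by auto
  from orthonormal_basis_extend[OF v(1,2)] obtain w c where
    w: "orthonormal_basis ?N w" and w0: "w 0 = c \<cdot>\<^sub>v v" by blast
  have wc: "w i \<in> carrier_vec ?N" if "i < ?N" for i
    using w that by (simp add: orthonormal_basis_def)
  have Aw0: "A *\<^sub>v w 0 = e \<cdot>\<^sub>v w 0"
    using A v by (simp add: w0 mult_mat_vec smult_smult_assoc mult.commute)
  define W where "W = basis_mat ?N w"
  have W [simp]: "W \<in> carrier_mat ?N ?N" by (simp add: W_def)
  have WW: "mat_adjoint W * W = 1\<^sub>m ?N" "W * mat_adjoint W = 1\<^sub>m ?N"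
    unfolding W_def using orthonormal_basis_unitary[OF w] by auto
  define B where "B = mat_adjoint W * A * W"
  have B [simp]: "B \<in> carrier_mat ?N ?N" using A by (auto simp: B_def intro!: carr)
  have B_herm: "mat_adjoint B = B"
    using A herm unfolding B_def
    by (simp add: mat_adjoint_mult[of _ ?N ?N _ ?N] carr assoc)
  have B_cnj: "B $$ (i, j) = cnj (B $$ (j, i))" if "i < ?N" "j < ?N" for i j
    using mat_adjoint_index[of i B j] B that by (simp add: B_herm)
  \<comment> \<open>The first basis vector is an eigenvector, so the first column of
    \<open>B\<close> consists of \<open>e\<close> times the inner products of \<open>w 0\<close>
    with the \<open>w i\<close>; Hermitian symmetry then clears the first row too.\<close>
  have B_col: "B $$ (i, 0) = (if i = 0 then e else 0)" if "i < ?N" for i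
  proof -
    have "B $$ (i, 0) = (e \<cdot>\<^sub>v w 0) \<bullet>c w i"
      unfolding B_def W_def Aw0[symmetric]
      using that wc by (intro basis_mat_congruence_index[OF A that]) auto
    also have "\<dots> = e * (w 0 \<bullet>c w i)"
      using wc[of 0] wc[OF that] by simp
    finally show ?thesis using w that by (simp add: orthonormal_basis_def)
  qed
  have B_row: "B $$ (0, j) = (if j = 0 then e else 0)" if "j < ?N" for j
  proof (cases "j = 0")
    case False
    have "B $$ (0, j) = cnj (B $$ (j, 0))" by (rule B_cnj) (use that in auto)
    then show ?thesis using B_col[OF that] False by simp
  qed (use B_col in simp)
  \<comment> \<open>A diagonal entry of a Hermitian matrix is its own conjugate; \<open>e\<close>
    must be real to enter the real family \<open>nu\<close>.\<close>
  have "e = cnj e" by (metis B_cnj B_col zero_less_Suc)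
  then have e: "e = complex_of_real (Re e)" by (simp add: complex_eq_iff)
  define C where "C = mat n n (\<lambda>(i, j). B $$ (Suc i, Suc j))"
  have "mat_adjoint C = C"
    by (rule eq_matI) (auto simp: C_def intro: B_cnj[symmetric])
  with Suc.IH[of C] obtain mu x where x: "spectral_decomposition n C mu x"
    by (auto simp: C_def)
  then have xo: "orthonormal_basis n x" and C_eq: "C = spectral_sum n mu x"
    by (auto simp: spectral_decomposition_def)
  have xc: "x i \<in> carrier_vec n" if "i < n" for i
    using xo that by (simp add: orthonormal_basis_def)
  \<comment> \<open>Eigenvectors of \<open>B\<close>: the first unit vector for \<open>e\<close>,
    and those of the block \<open>C\<close> extended by a leading zero.\<close>
  define y where "y i = (case i of 0 \<Rightarrow> unit_vec ?N 0 | Suc k \<Rightarrow> vCons 0 (x k))" for i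
  define nu where "nu i = (case i of 0 \<Rightarrow> Re e | Suc k \<Rightarrow> mu k)" for i
  have yo: "orthonormal_basis ?N y"
    unfolding orthonormal_basis_def
  proof safe
    fix i j assume ij: "i < ?N" "j < ?N"
    show "y i \<in> carrier_vec ?N" using ij xc by (auto simp: y_def split: nat.split)
    have xx: "x k \<bullet>c x l = (if k = l then 1 else 0)" if "k < n" "l < n" for k l
      using xo that by (simp add: orthonormal_basis_def)
    show "y i \<bullet>c y j = (if i = j then 1 else 0)"
      using ij xc by (cases i; cases j) (simp_all add: y_def xx unit_vec_cscalar_prod_vCons)
  qed
  have "B = spectral_sum ?N nu y"
  proof (rule eq_matI, goal_cases)
    case (1 i j)
    then have ij: "i < ?N" "j < ?N" by (auto simp: spectral_sum_def)
    \<comment> \<open>The summand with index 0 lives in the corner only, while the remaining ones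
      vanish in row 0 and column 0.\<close>
    have shift: "spectral_sum ?N nu y $$ (i, j)
        = e * unit_vec ?N 0 $ i * cnj (unit_vec ?N 0 $ j)
          + (\<Sum>k<n. complex_of_real (mu k) * vCons 0 (x k) $ i * cnj (vCons 0 (x k) $ j))"
      using ij by (simp add: spectral_sum_def sum.lessThan_Suc_shift nu_def y_def e[symmetric]
          del: sum.lessThan_Suc)
    show ?case
    proof (cases "i = 0 \<or> j = 0")
      case True
      then show ?thesis unfolding shift using ij B_col B_row by auto
    next
      case False
      then obtain i' j' where i': "i = Suc i'" "j = Suc j'" by (metis not0_implies_Suc)
      then have "B $$ (i, j) = C $$ (i', j')" using ij by (simp add: C_def)
      also have "\<dots> = (\<Sum>k<n. complex_of_real (mu k) * x k $ i' * cnj (x k $ j'))"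
        using ij i' by (simp add: C_eq spectral_sum_def)
      also have "\<dots> = spectral_sum ?N nu y $$ (i, j)"
        unfolding shift using ij i' xc by (auto intro!: sum.cong simp: vec_index_vCons)
      finally show ?thesis .
    qed
  qed (auto simp: spectral_sum_def B_def W_def)
  define Y where "Y = basis_mat ?N y"
  have Y [simp]: "Y \<in> carrier_mat ?N ?N" by (simp add: Y_def)
  have YY: "mat_adjoint Y * Y = 1\<^sub>m ?N"
    unfolding Y_def using orthonormal_basis_unitary[OF yo] by auto
  have B_eq: "B = Y * (real_diag ?N nu * mat_adjoint Y)"
    using \<open>B = spectral_sum ?N nu y\<close>
    by (simp add: spectral_sum_eq Y_def assoc)
  \<comment> \<open>Undoing the change of basis shows that the columns of \<open>W * Y\<close>
    diagonalise \<open>A\<close>.\<close>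
  have "A = W * B * mat_adjoint W"
    using A unfolding B_def by (simp add: carr assoc WW mult_mat_cancel_left[of _ _ ?N])
  also have "\<dots> = (W * Y) * real_diag ?N nu * mat_adjoint (W * Y)"
    unfolding B_eq by (simp add: carr assoc mat_adjoint_mult[of _ ?N ?N _ ?N])
  finally have A_eq: "A = (W * Y) * real_diag ?N nu * mat_adjoint (W * Y)" .
  have "mat_adjoint (W * Y) * (W * Y) = 1\<^sub>m ?N"
    by (simp add: carr assoc mat_adjoint_mult[of _ ?N ?N _ ?N] WW YY mult_mat_cancel_left[of _ _ ?N])
  from spectral_decomposition_of_unitary[OF carr[OF W Y] this, of nu] show ?case
    unfolding A_eq[symmetric] by blast
qed

text \<open>The transition matrix \<open>W\<close> between the two eigenbases intertwines the two
  diagonal matrices. Entrywise, \<open>W $$ (i, j)\<close> vanishes unless \<open>a j = b i\<close>,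
  and in that case \<open>f (a j) = f (b i)\<close>; so \<open>W\<close> also intertwines the
  diagonals after applying \<open>f\<close>.\<close>

lemma spectral_sum_fun_unique:
  assumes u: "orthonormal_basis n u" and v: "orthonormal_basis n v"
    and eq: "spectral_sum n a u = spectral_sum n b v"
  shows "spectral_sum n (\<lambda>i. f (a i)) u = spectral_sum n (\<lambda>i. f (b i)) v"
proof -
  note assoc = assoc_mult_mat[of _ n n _ n _ n]
  note carr = mult_carrier_mat[of _ n n _ n]
  note cancel = mult_mat_cancel_left[of _ _ n]
  define U where "U = basis_mat n u"
  define V where "V = basis_mat n v"
  have [simp]: "U \<in> carrier_mat n n" "V \<in> carrier_mat n n" by (simp_all add: U_def V_def)
  note UU = orthonormal_basis_unitary[OF u, folded U_def]
  note VV = orthonormal_basis_unitary[OF v, folded V_def]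
  define W where "W = mat_adjoint V * U"
  have W [simp]: "W \<in> carrier_mat n n" by (simp add: W_def carr)
  have eq': "U * (real_diag n a * mat_adjoint U) = V * (real_diag n b * mat_adjoint V)"
    using eq by (simp add: spectral_sum_eq U_def V_def assoc)
  \<comment> \<open>Both forms of the same operator are placed between \<open>mat_adjoint V\<close>
    and \<open>U\<close>.\<close>
  have "W * real_diag n a = mat_adjoint V * (U * (real_diag n a * mat_adjoint U)) * U"
    by (simp add: W_def carr assoc UU)
  also have "\<dots> = real_diag n b * W"
    unfolding eq' by (simp add: W_def carr assoc VV cancel)
  finally have comm: "W * real_diag n a = real_diag n b * W" .
  have "W * real_diag n (\<lambda>i. f (a i)) = real_diag n (\<lambda>i. f (b i)) * W"
  proof (rule eq_matI, goal_cases)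
    case (1 i j)
    then have ij: "i < n" "j < n" using W by auto
    have "W $$ (i, j) * complex_of_real (a j) = complex_of_real (b i) * W $$ (i, j)"
      using arg_cong[OF comm, of "\<lambda>M. M $$ (i, j)"] ij
      by (simp add: mult_real_diag_index[of _ n] real_diag_mult_index[of _ _ n]
          del: index_mult_mat(1))
    then have "W $$ (i, j) = 0 \<or> a j = b i" by auto
    then show ?case
      using ij by (auto simp: mult_real_diag_index[of _ n] real_diag_mult_index[of _ _ n]
          simp del: index_mult_mat(1))
  qed (auto simp: W_def U_def V_def)
  then have "V * (W * real_diag n (\<lambda>i. f (a i))) * mat_adjoint U
      = V * (real_diag n (\<lambda>i. f (b i)) * W) * mat_adjoint U" by simp
  then show ?thesis
    unfolding spectral_sum_eq U_def[symmetric] V_def[symmetric] W_def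
    by (simp add: carr assoc UU VV cancel right_mult_one_mat[of _ n n])
qed

text \<open>Resolves the definite description: the given decomposition supplies a witness, and
  independence of the decomposition makes it unique.\<close>

lemma fun_calc_eq:
  assumes "spectral_decomposition n X lam u"
  shows "fun_calc f X = spectral_sum n (\<lambda>i. f (lam i)) u"
proof -
  have dim: "dim_row X = n"
    using assms by (auto simp: spectral_decomposition_def spectral_sum_def)
  show ?thesis
    unfolding fun_calc_def dim
  proof (rule the_equality)
    show "\<exists>lam' u'. spectral_decomposition n X lam' u' \<and>
        spectral_sum n (\<lambda>i. f (lam i)) u = spectral_sum n (\<lambda>i. f (lam' i)) u'"
      using assms by blast
  next
    fix Y
    assume "\<exists>lam' u'. spectral_decomposition n X lam' u' \<and> Y = spectral_sum n (\<lambda>i. f (lam' i)) u'"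
    then obtain lam' u' where "spectral_decomposition n X lam' u'"
      and Y: "Y = spectral_sum n (\<lambda>i. f (lam' i)) u'" by blast
    then show "Y = spectral_sum n (\<lambda>i. f (lam i)) u"
      unfolding Y using assms
      by (intro spectral_sum_fun_unique[of n u' u lam' lam f]) (simp_all add: spectral_decomposition_def)
  qed
qed

subsection \<open>Positivity and measure-and-prepare channels\<close>

lemma psd_carrier: "psd n A \<Longrightarrow> A \<in> carrier_mat n n"
  by (simp add: psd_def)

text \<open>The quadratic form written out over plain functions, of which only the values below
  \<open>n\<close> enter. It is visibly linear in \<open>A\<close>, which suits sums of matrices and
  diagonal matrices.\<close>

lemma psd_iff:
  "psd n A \<longleftrightarrow> A \<in> carrier_mat n n \<and> mat_adjoint A = A \<and>
     (\<forall>v :: nat \<Rightarrow> complex. 0 \<le> Re (\<Sum>i<n. \<Sum>j<n. A $$ (i, j) * v j * cnj (v i)))"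
proof -
  have form: "(A *\<^sub>v v) \<bullet>c v = (\<Sum>i<n. \<Sum>j<n. A $$ (i, j) * v $ j * cnj (v $ i))"
    if "A \<in> carrier_mat n n" "v \<in> carrier_vec n" for v
    using that
    by (subst cscalar_prod_sum[of _ n])
      (auto simp: mult_mat_vec_index sum_distrib_right simp del: index_mult_mat_vec
        intro!: sum.cong)
  have "(\<forall>v\<in>carrier_vec n. 0 \<le> Re ((A *\<^sub>v v) \<bullet>c v)) \<longleftrightarrow>
      (\<forall>v. 0 \<le> Re (\<Sum>i<n. \<Sum>j<n. A $$ (i, j) * v j * cnj (v i)))"
    if A: "A \<in> carrier_mat n n"
  proof safe
    fix v :: "nat \<Rightarrow> complex"
    assume "\<forall>v\<in>carrier_vec n. 0 \<le> Re ((A *\<^sub>v v) \<bullet>c v)"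
    then have "0 \<le> Re ((A *\<^sub>v vec n v) \<bullet>c vec n v)" by simp
    then show "0 \<le> Re (\<Sum>i<n. \<Sum>j<n. A $$ (i, j) * v j * cnj (v i))"
      using A by (simp add: form)
  next
    fix v :: "complex vec"
    assume "\<forall>v. 0 \<le> Re (\<Sum>i<n. \<Sum>j<n. A $$ (i, j) * v j * cnj (v i))" "v \<in> carrier_vec n"
    then show "0 \<le> Re ((A *\<^sub>v v) \<bullet>c v)"
      using A by (simp only: form)
  qed
  then show ?thesis unfolding psd_def by blast
qed

text \<open>Moving \<open>mat_adjoint B\<close> across the inner product turns the form at
  \<open>v\<close> into the form of \<open>A\<close> at \<open>B *\<^sub>v v\<close>.\<close>

lemma psd_congruence:
  assumes A: "psd n A" and B: "B \<in> carrier_mat n m"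
  shows "psd m (mat_adjoint B * A * B)"
  unfolding psd_def
proof (intro conjI ballI)
  have Ac: "A \<in> carrier_mat n n" and herm: "mat_adjoint A = A" using A by (auto simp: psd_def)
  have B': "mat_adjoint B \<in> carrier_mat m n" using B by simp
  have B'A: "mat_adjoint B * A \<in> carrier_mat m n" using B' Ac by simp
  show "mat_adjoint B * A * B \<in> carrier_mat m m" using B'A B by simp
  show "mat_adjoint (mat_adjoint B * A * B) = mat_adjoint B * A * B"
    unfolding mat_adjoint_mult[OF B'A B] mat_adjoint_mult[OF B' Ac] mat_adjoint_adjoint herm
    by (rule assoc_mult_mat[symmetric, OF B' Ac B])
  fix v :: "complex vec"
  assume v: "v \<in> carrier_vec m"
  have Bv: "B *\<^sub>v v \<in> carrier_vec n" using B v by (rule mult_mat_vec_carrier)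
  have ABv: "A *\<^sub>v (B *\<^sub>v v) \<in> carrier_vec n" using Ac Bv by (rule mult_mat_vec_carrier)
  have "mat_adjoint B * A * B *\<^sub>v v = mat_adjoint B *\<^sub>v (A *\<^sub>v (B *\<^sub>v v))"
    by (simp add: assoc_mult_mat_vec[OF B'A B v] assoc_mult_mat_vec[OF B' Ac Bv])
  then have "(mat_adjoint B * A * B *\<^sub>v v) \<bullet>c v = (A *\<^sub>v (B *\<^sub>v v)) \<bullet>c (B *\<^sub>v v)"
    using cscalar_prod_adjoint[OF B' ABv v] by simp
  then show "0 \<le> Re ((mat_adjoint B * A * B *\<^sub>v v) \<bullet>c v)"
    using A Bv by (simp add: psd_def)
qed

text \<open>A congruence in disguise: column \<open>x\<close> of \<open>B\<close> is
  \<open>g x\<close> times the unit vector at \<open>\<phi> x\<close>. This allows the selection of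
  entries of \<open>A\<close> along an arbitrary index map, together with a scaling.\<close>

lemma psd_pullback:
  assumes A: "psd N A" and \<phi>: "\<And>x. x < M \<Longrightarrow> \<phi> x < N"
  shows "psd M (mat M M (\<lambda>(x, y). A $$ (\<phi> x, \<phi> y) * g y * cnj (g x)))"
proof -
  define B where "B = mat N M (\<lambda>(z, x). if z = \<phi> x then g x else 0)"
  have B: "B \<in> carrier_mat N M" by (simp add: B_def)
  have Ac: "A \<in> carrier_mat N N" using A by (rule psd_carrier)
  have AB: "A * B \<in> carrier_mat N M" using Ac B by simp
  have "(A * B) $$ (z, y) = A $$ (z, \<phi> y) * g y" if "z < N" "y < M" for z y
    unfolding mult_mat_index[OF Ac B that] using that \<phi>[of y]
    by (simp add: B_def if_distrib[of "\<lambda>x. _ * x"] cong: if_cong)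
  then have "mat_adjoint B * (A * B) = mat M M (\<lambda>(x, y). A $$ (\<phi> x, \<phi> y) * g y * cnj (g x))"
    using B AB \<phi>
    by (intro eq_matI)
      (auto simp: mult_mat_index[of _ M N _ M] B_def if_distrib[of "\<lambda>x. x * _"] if_distrib[of cnj]
        simp del: index_mult_mat(1) cong: if_cong)
  then show ?thesis
    using psd_congruence[OF A B] assoc_mult_mat[OF mat_adjoint_carrier[OF B] Ac B] by simp
qed

lemma psd_nonneg_combination:
  assumes F: "\<And>i. i < k \<Longrightarrow> psd n (F i)" and c: "\<And>i. i < k \<Longrightarrow> 0 \<le> c i"
  shows "psd n (mat n n (\<lambda>(x, y). \<Sum>i<k. complex_of_real (c i) * F i $$ (x, y)))"
  unfolding psd_iff
proof (intro conjI allI)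
  have Fc: "F i \<in> carrier_mat n n" if "i < k" for i using F[OF that] by (rule psd_carrier)
  have Fh: "cnj (F i $$ (y, x)) = F i $$ (x, y)" if "i < k" "x < n" "y < n" for i x y
  proof -
    have "mat_adjoint (F i) $$ (x, y) = cnj (F i $$ (y, x))"
      using Fc[OF that(1)] that by (intro mat_adjoint_index) auto
    moreover have "mat_adjoint (F i) = F i" using F[OF that(1)] by (simp add: psd_def)
    ultimately show ?thesis by simp
  qed
  show "mat_adjoint (mat n n (\<lambda>(x, y). \<Sum>i<k. complex_of_real (c i) * F i $$ (x, y)))
      = mat n n (\<lambda>(x, y). \<Sum>i<k. complex_of_real (c i) * F i $$ (x, y))"
    by (rule eq_matI) (auto simp: Fh intro!: sum.cong)
  fix v :: "nat \<Rightarrow> complex"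
  have "(\<Sum>x<n. \<Sum>y<n. mat n n (\<lambda>(x, y). \<Sum>i<k. complex_of_real (c i) * F i $$ (x, y)) $$ (x, y)
        * v y * cnj (v x))
      = (\<Sum>x<n. \<Sum>y<n. \<Sum>i<k. complex_of_real (c i) * (F i $$ (x, y) * v y * cnj (v x)))"
    by (auto simp: sum_distrib_right mult.assoc intro!: sum.cong)
  also have "\<dots> = (\<Sum>x<n. \<Sum>i<k. \<Sum>y<n. complex_of_real (c i) * (F i $$ (x, y) * v y * cnj (v x)))"
    by (intro sum.cong refl sum.swap)
  also have "\<dots> = (\<Sum>i<k. \<Sum>x<n. \<Sum>y<n. complex_of_real (c i) * (F i $$ (x, y) * v y * cnj (v x)))"
    by (rule sum.swap)
  also have "\<dots> = (\<Sum>i<k. complex_of_real (c i) * (\<Sum>x<n. \<Sum>y<n. F i $$ (x, y) * v y * cnj (v x)))"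
    by (simp add: sum_distrib_left)
  finally have eq: "(\<Sum>x<n. \<Sum>y<n.
      mat n n (\<lambda>(x, y). \<Sum>i<k. complex_of_real (c i) * F i $$ (x, y)) $$ (x, y) * v y * cnj (v x))
      = (\<Sum>i<k. complex_of_real (c i) * (\<Sum>x<n. \<Sum>y<n. F i $$ (x, y) * v y * cnj (v x)))" .
  have Re: "Re (\<Sum>i<k. complex_of_real (c i) * Z i) = (\<Sum>i<k. c i * Re (Z i))" for Z
    by simp
  show "0 \<le> Re (\<Sum>x<n. \<Sum>y<n.
      mat n n (\<lambda>(x, y). \<Sum>i<k. complex_of_real (c i) * F i $$ (x, y)) $$ (x, y) * v y * cnj (v x))"
    unfolding eq Re
  proof (intro sum_nonneg mult_nonneg_nonneg)
    fix i assume "i \<in> {..<k}"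
    then show "0 \<le> c i" "0 \<le> Re (\<Sum>x<n. \<Sum>y<n. F i $$ (x, y) * v y * cnj (v x))"
      using F c by (simp_all add: psd_iff del: Re_sum)
  qed
qed simp

text \<open>Outcome \<open>i\<close> of the measurement has weight \<open>A $$ (i, i)\<close> and
  prepares \<open>c i\<close> times the rank-one operator of column \<open>i\<close> of
  \<open>P\<close>. The separate factor \<open>c i\<close> lets \<open>P\<close> keep unnormalised
  columns: it is meant to be the inverse squared norm of column \<open>i\<close>.\<close>

definition measure_prepare ::
  "nat \<Rightarrow> nat \<Rightarrow> (nat \<Rightarrow> real) \<Rightarrow> complex mat \<Rightarrow> complex mat \<Rightarrow> complex mat" where
  "measure_prepare n m c P A =
     mat m m (\<lambda>(x, y). \<Sum>i<n. complex_of_real (c i) * (A $$ (i, i) * P $$ (x, i) * cnj (P $$ (y, i))))"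

text \<open>The hypothesis \<open>norm\<close> says that every prepared operator has trace one,
  which yields trace preservation. Complete positivity holds because each outcome contributes a
  pullback of \<open>A\<close>, and the weights are nonnegative.\<close>

lemma quantum_channel_measure_prepare:
  assumes c: "\<And>i. i < n \<Longrightarrow> 0 \<le> c i"
    and norm: "\<And>i. i < n \<Longrightarrow>
      complex_of_real (c i) * (\<Sum>x<m. P $$ (x, i) * cnj (P $$ (x, i))) = 1"
  shows "quantum_channel n m (measure_prepare n m c P)"
  unfolding quantum_channel_def
proof (intro conjI allI ballI impI)
  fix A B :: "complex mat"
  assume "A \<in> carrier_mat n n" "B \<in> carrier_mat n n"
  then show "measure_prepare n m c P (A + B) = measure_prepare n m c P A + measure_prepare n m c P B"
    by (intro eq_matI)
      (simp_all add: measure_prepare_def sum.distrib ring_distribs cong: sum.cong_simp)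
next
  fix a and A :: "complex mat"
  assume "A \<in> carrier_mat n n"
  then show "measure_prepare n m c P (a \<cdot>\<^sub>m A) = a \<cdot>\<^sub>m measure_prepare n m c P A"
    by (intro eq_matI)
      (simp_all add: measure_prepare_def sum_distrib_left mult_ac cong: sum.cong_simp)
next
  fix k and A :: "complex mat"
  assume A: "psd (k * n) A"
  \<comment> \<open>The ampliation of the channel is the combination \<open>\<Sum>\<^sub>i c\<^sub>i F\<^sub>i\<close>, where \<open>F\<^sub>i\<close> only sees the
    entries of \<open>A\<close> at the \<open>i\<close>-th place of each block.\<close>
  define F where "F i = mat (k * m) (k * m) (\<lambda>(x, y).
      A $$ (x div m * n + i, y div m * n + i) * cnj (P $$ (y mod m, i)) * cnj (cnj (P $$ (x mod m, i))))" for i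
  have "psd (k * m) (F i)" if i: "i < n" for i
    unfolding F_def
  \<comment> \<open>The index map is \<open>x \<mapsto> x div m * n + i\<close>, and the scaling is
    \<open>g x = cnj (P $$ (x mod m, i))\<close>, whence the double conjugate in
    \<open>F\<close>.\<close>
  proof (rule psd_pullback[OF A])
    fix x assume "x < k * m"
    then have "Suc (x div m) \<le> k" by (simp add: less_mult_imp_div_less Suc_le_eq)
    from mult_le_mono1[OF this, of n] i show "x div m * n + i < k * n" by simp
  qed
  then have "psd (k * m) (mat (k * m) (k * m) (\<lambda>(x, y). \<Sum>i<n. complex_of_real (c i) * F i $$ (x, y)))"
    using c by (rule psd_nonneg_combination)
  also have "mat (k * m) (k * m) (\<lambda>(x, y). \<Sum>i<n. complex_of_real (c i) * F i $$ (x, y))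
      = ampliation k n m (measure_prepare n m c P) A"
  proof (rule eq_matI, goal_cases)
    case (1 x y)
    then have xy: "x < k * m" "y < k * m" by (auto simp: ampliation_def)
    \<comment> \<open>An index below \<open>k * m\<close> forces \<open>m\<close> to be
      positive.\<close>
    then have "x mod m < m" "y mod m < m" by (auto intro!: mod_less_divisor Nat.gr0I)
    then show ?case using xy
      by (auto simp: ampliation_def measure_prepare_def mat_block_def F_def intro!: sum.cong)
  qed (auto simp: ampliation_def)
  finally show "psd (k * m) (ampliation k n m (measure_prepare n m c P) A)" .
next
  fix A :: "complex mat"
  assume A: "A \<in> carrier_mat n n"
  have "mat_trace (measure_prepare n m c P A)
      = (\<Sum>x<m. \<Sum>i<n. complex_of_real (c i) * (A $$ (i, i) * P $$ (x, i) * cnj (P $$ (x, i))))"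
    by (simp add: mat_trace_def measure_prepare_def)
  also have "\<dots> = (\<Sum>i<n. \<Sum>x<m. complex_of_real (c i) * (A $$ (i, i) * P $$ (x, i) * cnj (P $$ (x, i))))"
    by (rule sum.swap)
  also have "\<dots> = (\<Sum>i<n. A $$ (i, i) * (complex_of_real (c i) * (\<Sum>x<m. P $$ (x, i) * cnj (P $$ (x, i)))))"
    by (auto simp: sum_distrib_left mult_ac intro!: sum.cong)
  also have "\<dots> = mat_trace A" using A by (simp add: norm mat_trace_def)
  finally show "mat_trace (measure_prepare n m c P A) = mat_trace A" .
qed (simp add: measure_prepare_def)

lemma real_diag_congruence_index:
  assumes P: "P \<in> carrier_mat m n" and "x < m" "y < m"
  shows "(P * real_diag n c * mat_adjoint P) $$ (x, y)
    = (\<Sum>i<n. complex_of_real (c i) * (P $$ (x, i) * cnj (P $$ (y, i))))"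
proof -
  have "P * real_diag n c \<in> carrier_mat m n" using P by (simp add: mult_carrier_mat[of _ m n])
  then show ?thesis
    using assms
    by (subst mult_mat_index[of _ m n _ m])
      (auto simp: mult_real_diag_index[OF P] mult_ac simp del: index_mult_mat(1) intro!: sum.cong)
qed

text \<open>On diagonal inputs the channel is a congruence by \<open>P\<close> after reweighting by
  \<open>c\<close>; this is how commuting states are carried to operators that need not
  commute.\<close>

lemma measure_prepare_real_diag:
  assumes "P \<in> carrier_mat m n"
  shows "measure_prepare n m c P (real_diag n a) = P * real_diag n (\<lambda>i. c i * a i) * mat_adjoint P"
proof (rule eq_matI, goal_cases)
  case (1 x y)
  then show ?case
    using assms
    by (auto simp: real_diag_congruence_index measure_prepare_def simp del: index_mult_mat(1)
        intro!: sum.cong) (simp add: real_diag_def mult_ac)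
qed (use assms in \<open>auto simp: measure_prepare_def\<close>)

section \<open>Probability distributions as diagonal states\<close>

lemma quantum_state_real_diag:
  assumes "prob_dist n p"
  shows "quantum_state n (real_diag n p)"
proof -
  have "0 \<le> Re (\<Sum>i<n. \<Sum>j<n. real_diag n p $$ (i, j) * v j * cnj (v i))" for v
  proof -
    have "(\<Sum>i<n. \<Sum>j<n. real_diag n p $$ (i, j) * v j * cnj (v i))
        = (\<Sum>i<n. complex_of_real (p i * (cmod (v i))\<^sup>2))"
      by (auto simp: real_diag_def if_distrib[of "\<lambda>x. x * _"] complex_norm_square mult.assoc
          simp del: of_real_power cong: if_cong intro!: sum.cong)
    then show ?thesis
      using assms by (auto simp: prob_dist_def intro!: sum_nonneg)
  qed
  moreover have "mat_trace (real_diag n p) = 1"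
    using assms by (simp add: mat_trace_def real_diag_def prob_dist_def flip: of_real_sum)
  ultimately show ?thesis
    by (simp add: quantum_state_def psd_iff)
qed

text \<open>Diagonal states commute and share the standard basis as eigenbasis, so the classical
  axiom determines their divergence.\<close>

lemma quantum_f_divergence_real_diag:
  assumes D: "quantum_f_divergence f D" and p: "prob_dist n p" and q: "prob_dist n q"
  shows "D (real_diag n p) (real_diag n q) = classical_f_divergence f n p q"
proof -
  have eig: "real_diag n a *\<^sub>v unit_vec n i = complex_of_real (a i) \<cdot>\<^sub>v unit_vec n i" if "i < n" for a i
    using that
    by (intro eq_vecI) (auto simp: real_diag_def)
  have "real_diag n p * real_diag n q = real_diag n q * real_diag n p"
    by (simp add: real_diag_mult mult.commute)
  moreover have "orthonormal_basis n (unit_vec n)"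
    by (auto simp: orthonormal_basis_def cscalar_prod_sum if_distrib[of cnj] cong: if_cong)
  ultimately show ?thesis
    using D quantum_state_real_diag[OF p] quantum_state_real_diag[OF q] eig
    unfolding quantum_f_divergence_def by blast
qed

subsection \<open>Square roots and the maximal divergence\<close>

lemma spectral_decomposition_eigenvalue:
  assumes "spectral_decomposition n X lam u" "i < n"
  shows "(X *\<^sub>v u i) \<bullet>c u i = complex_of_real (lam i)"
proof -
  note assoc = assoc_mult_mat[of _ n n _ n _ n]
  note carr = mult_carrier_mat[of _ n n _ n]
  define U where "U = basis_mat n u"
  have U [simp]: "U \<in> carrier_mat n n" by (simp add: U_def)
  have u: "orthonormal_basis n u" and X: "X = U * real_diag n lam * mat_adjoint U"
    using assms by (auto simp: spectral_decomposition_def spectral_sum_eq U_def)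
  note UU = orthonormal_basis_unitary[OF u, folded U_def]
  have "(X *\<^sub>v u i) \<bullet>c u i = (mat_adjoint U * X * U) $$ (i, i)"
    unfolding U_def using u assms(2)
    by (subst basis_mat_congruence_index) (auto simp: X carr orthonormal_basis_def)
  also have "mat_adjoint U * X * U = real_diag n lam"
    by (simp add: X assoc carr UU mult_mat_cancel_left[of _ _ n] right_mult_one_mat[of _ n n])
  finally show ?thesis using assms(2) by (simp add: real_diag_def)
qed

lemma psd_eigenvalue_nonneg:
  assumes "psd n X" "spectral_decomposition n X lam u" "i < n"
  shows "0 \<le> lam i"
proof -
  have "u i \<in> carrier_vec n"
    using assms(2,3) by (simp add: spectral_decomposition_def orthonormal_basis_def)
  then have "0 \<le> Re ((X *\<^sub>v u i) \<bullet>c u i)" using assms(1) by (simp add: psd_def)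
  then show ?thesis by (simp add: spectral_decomposition_eigenvalue[OF assms(2,3)])
qed

text \<open>A zero eigenvalue would produce a zero row in the diagonal factor, whereas a right
  inverse of \<open>X\<close>, moved to the eigenbasis, is a right inverse of that factor.\<close>

lemma invertible_eigenvalue_nonzero:
  assumes "invertible_mat X" "spectral_decomposition n X lam u" "i < n"
  shows "lam i \<noteq> 0"
proof
  assume "lam i = 0"
  note assoc = assoc_mult_mat[of _ n n _ n _ n]
  note carr = mult_carrier_mat[of _ n n _ n]
  define U where "U = basis_mat n u"
  have U [simp]: "U \<in> carrier_mat n n" by (simp add: U_def)
  have u: "orthonormal_basis n u" and X: "X = U * real_diag n lam * mat_adjoint U"
    using assms(2) by (auto simp: spectral_decomposition_def spectral_sum_eq U_def)
  note UU = orthonormal_basis_unitary[OF u, folded U_def]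
  have Xc: "X \<in> carrier_mat n n" by (simp add: X carr)
  from assms(1) obtain R where R: "X * R = 1\<^sub>m (dim_row X)" "R * X = 1\<^sub>m (dim_row R)"
    by (auto simp: invertible_mat_def inverts_mat_def)
  have XR: "X * R = 1\<^sub>m n" using R Xc by simp
  \<comment> \<open>The inverse comes without a size; the column counts of the two product equations
    determine it.\<close>
  have Rc: "R \<in> carrier_mat n n"
    using arg_cong[OF XR, of dim_col] arg_cong[OF R(2), of dim_col] Xc by auto
  have "real_diag n lam * (mat_adjoint U * (R * U)) = mat_adjoint U * (X * R) * U"
    using Rc by (simp add: X assoc carr UU mult_mat_cancel_left[of _ _ n])
  also have "\<dots> = 1\<^sub>m n" by (simp add: XR UU right_mult_one_mat[of _ n n])
  finally have *: "real_diag n lam * (mat_adjoint U * (R * U)) = 1\<^sub>m n" .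
  have "(real_diag n lam * (mat_adjoint U * (R * U))) $$ (i, i) = 0"
    using Rc assms(3) \<open>lam i = 0\<close>
    by (subst real_diag_mult_index[of _ _ n]) (auto simp: carr)
  then show False unfolding * using assms(3) by simp
qed

section \<open>Algebra of spectral sums and the square roots of a positive operator\<close>

lemma spectral_sum_adjoint [simp]:
  "mat_adjoint (spectral_sum n c u) = spectral_sum n c u"
  by (rule eq_matI) (auto simp: spectral_sum_def mult_ac)

lemma spectral_sum_carrier [simp]: "spectral_sum n c u \<in> carrier_mat n n"
  by (simp add: spectral_sum_def)

lemma spectral_sum_mult:
  assumes "orthonormal_basis n u"
  shows "spectral_sum n a u * spectral_sum n b u = spectral_sum n (\<lambda>i. a i * b i) u"
proof -
  define U where "U = basis_mat n u"
  have U [simp]: "U \<in> carrier_mat n n" by (simp add: U_def)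
  note UU = orthonormal_basis_unitary[OF assms, folded U_def]
  have "real_diag n a * (real_diag n b * mat_adjoint U)
      = real_diag n (\<lambda>i. a i * b i) * mat_adjoint U"
    by (simp add: real_diag_mult assoc_mult_mat[of _ n n _ n _ n, symmetric])
  then show ?thesis
    by (simp add: spectral_sum_eq flip: U_def)
      (simp add: assoc_mult_mat[of _ n n _ n _ n] mult_carrier_mat[of _ n n _ n] UU
        mult_mat_cancel_left[of _ _ n])
qed

lemma spectral_sum_one:
  assumes "orthonormal_basis n u" "\<And>i. i < n \<Longrightarrow> c i = 1"
  shows "spectral_sum n c u = 1\<^sub>m n"
  using assms
  by (simp add: spectral_sum_eq real_diag_one orthonormal_basis_unitary right_mult_one_mat[of _ n n])

lemma spectral_sum_cong:
  "(\<And>i. i < n \<Longrightarrow> a i = b i) \<Longrightarrow> spectral_sum n a u = spectral_sum n b u"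
  by (auto simp: spectral_sum_def intro!: cong_mat sum.cong)

lemma mat_sqrt_inv_sqrt:
  assumes "psd n A" "invertible_mat A"
  shows "mat_sqrt A \<in> carrier_mat n n" "mat_inv_sqrt A \<in> carrier_mat n n"
    "mat_adjoint (mat_sqrt A) = mat_sqrt A" "mat_adjoint (mat_inv_sqrt A) = mat_inv_sqrt A"
    "mat_sqrt A * mat_sqrt A = A"
    "mat_sqrt A * mat_inv_sqrt A = 1\<^sub>m n" "mat_inv_sqrt A * mat_sqrt A = 1\<^sub>m n"
proof -
  obtain lam u where dec: "spectral_decomposition n A lam u"
    using hermitian_spectral_decomposition[of A n] assms(1) by (auto simp: psd_def)
  then have u: "orthonormal_basis n u" and A: "A = spectral_sum n lam u"
    by (auto simp: spectral_decomposition_def)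
  \<comment> \<open>Strict positivity is essential: \<open>1 / sqrt 0\<close> is 0 by convention, so
    the two roots are mutually inverse only away from zero.\<close>
  have pos: "0 < lam i" if "i < n" for i
    using psd_eigenvalue_nonneg[OF assms(1) dec that]
      invertible_eigenvalue_nonzero[OF assms(2) dec that] by simp
  note S = fun_calc_eq[OF dec, of sqrt, folded mat_sqrt_def]
  note T = fun_calc_eq[OF dec, of "\<lambda>x. 1 / sqrt x", folded mat_inv_sqrt_def]
  show "mat_sqrt A \<in> carrier_mat n n" "mat_inv_sqrt A \<in> carrier_mat n n"
    "mat_adjoint (mat_sqrt A) = mat_sqrt A" "mat_adjoint (mat_inv_sqrt A) = mat_inv_sqrt A"
    by (simp_all add: S T)
  have pos': "lam i \<noteq> 0" "0 \<le> lam i" if "i < n" for i using pos[OF that] by auto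
  show "mat_sqrt A * mat_inv_sqrt A = 1\<^sub>m n" "mat_inv_sqrt A * mat_sqrt A = 1\<^sub>m n"
    unfolding S T spectral_sum_mult[OF u] using pos' by (auto intro!: spectral_sum_one[OF u])
  have "mat_sqrt A * mat_sqrt A = spectral_sum n lam u"
    unfolding S spectral_sum_mult[OF u] using pos' by (intro spectral_sum_cong) auto
  then show "mat_sqrt A * mat_sqrt A = A" by (simp flip: A)
qed

text \<open>The decomposition is a parameter, so the results serve both for one that is known to
  exist and for an arbitrary given one.\<close>

locale relative_spectral_decomposition =
  fixes n :: nat and \<rho> \<sigma> :: "complex mat" and lam :: "nat \<Rightarrow> real" and u :: "nat \<Rightarrow> complex vec"
  assumes \<rho>: "quantum_state n \<rho>" and \<sigma>: "quantum_state n \<sigma>" and inv: "invertible_mat \<sigma>"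
    and dec: "spectral_decomposition n (mat_inv_sqrt \<sigma> * \<rho> * mat_inv_sqrt \<sigma>) lam u"
begin

definition S :: "complex mat" where "S = mat_sqrt \<sigma>"
definition V :: "complex mat" where "V = basis_mat n u"
text \<open>A common factor of both states: \<open>P * mat_adjoint P\<close> is
  \<open>\<sigma>\<close>, and inserting \<open>real_diag n lam\<close> in the middle gives
  \<open>\<rho>\<close>.\<close>

definition P :: "complex mat" where "P = S * V"
definition s :: "nat \<Rightarrow> real" where "s i = Re ((\<sigma> *\<^sub>v u i) \<bullet>c u i)"

lemma psd_states: "psd n \<rho>" "psd n \<sigma>"
  using \<rho> \<sigma> by (simp_all add: quantum_state_def)

lemmas \<sigma>_sqrt = mat_sqrt_inv_sqrt[OF psd_states(2) inv, folded S_def]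

lemma u: "orthonormal_basis n u"
  using dec by (simp add: spectral_decomposition_def)

lemmas VV = orthonormal_basis_unitary[OF u, folded V_def]

lemma carriers [simp]:
  "\<rho> \<in> carrier_mat n n" "\<sigma> \<in> carrier_mat n n" "V \<in> carrier_mat n n" "P \<in> carrier_mat n n"
  "S \<in> carrier_mat n n" "mat_inv_sqrt \<sigma> \<in> carrier_mat n n"
  using \<sigma>_sqrt psd_states by (simp_all add: V_def P_def psd_carrier mult_carrier_mat[of _ n n])

lemmas assoc = assoc_mult_mat[of _ n n _ n _ n]
lemmas carr = mult_carrier_mat[of _ n n _ n]
lemmas cancel = mult_mat_cancel_left[of _ _ n]

lemma adjoint_P: "mat_adjoint P = mat_adjoint V * S"
  by (simp add: P_def mat_adjoint_mult[of _ n n _ n] \<sigma>_sqrt)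

lemma lam_nonneg:
  assumes "i < n"
  shows "0 \<le> lam i"
  using psd_congruence[OF psd_states(1) carriers(6)] \<sigma>_sqrt dec assms
  by (intro psd_eigenvalue_nonneg[OF _ dec]) simp_all

lemma P_real_diag: "P * real_diag n (\<lambda>i. f (lam i)) * mat_adjoint P
    = S * fun_calc f (mat_inv_sqrt \<sigma> * \<rho> * mat_inv_sqrt \<sigma>) * S"
  unfolding fun_calc_eq[OF dec] spectral_sum_eq adjoint_P V_def[symmetric]
  by (simp add: P_def assoc carr)

lemma P_one: "P * real_diag n (\<lambda>_. 1) * mat_adjoint P = \<sigma>"
  by (simp add: real_diag_one adjoint_P) (simp add: P_def assoc carr cancel VV \<sigma>_sqrt right_mult_one_mat[of _ n n])

lemma P_lam: "P * real_diag n lam * mat_adjoint P = \<rho>"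
proof -
  have "mat_inv_sqrt \<sigma> * \<rho> * mat_inv_sqrt \<sigma> = V * real_diag n lam * mat_adjoint V"
    using dec by (simp add: spectral_decomposition_def spectral_sum_eq V_def)
  then have "S * (mat_inv_sqrt \<sigma> * \<rho> * mat_inv_sqrt \<sigma>) * S = P * real_diag n lam * mat_adjoint P"
    unfolding adjoint_P by (simp add: P_def assoc carr)
  moreover have "S * (mat_inv_sqrt \<sigma> * \<rho> * mat_inv_sqrt \<sigma>) * S = \<rho>"
    by (simp add: assoc carr cancel \<sigma>_sqrt right_mult_one_mat[of _ n n])
  ultimately show ?thesis by simp
qed

text \<open>Both sides are the diagonal entry at \<open>i\<close> of
  \<open>mat_adjoint P * P\<close>, since \<open>\<sigma> = S * S\<close>. In particular the inner
  product is real, which justifies the real part in \<open>s\<close>.\<close>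

lemma column_norm:
  assumes "i < n"
  shows "(\<sigma> *\<^sub>v u i) \<bullet>c u i = (\<Sum>x<n. P $$ (x, i) * cnj (P $$ (x, i)))"
proof -
  have "(\<sigma> *\<^sub>v u i) \<bullet>c u i = (mat_adjoint V * \<sigma> * V) $$ (i, i)"
    unfolding V_def using u assms
    by (subst basis_mat_congruence_index) (auto simp: orthonormal_basis_def)
  also have "mat_adjoint V * \<sigma> * V = mat_adjoint V * (S * S) * V" by (simp add: \<sigma>_sqrt)
  also have "\<dots> = mat_adjoint P * P" by (simp add: adjoint_P, simp add: P_def assoc carr)
  finally show ?thesis
    using assms carrier_matD[OF carriers(4)]
    by (subst (asm) mult_mat_index[of _ n n _ n]) (auto simp: mult.commute)
qed

lemma column_norm_real: "i < n \<Longrightarrow> (\<Sum>x<n. P $$ (x, i) * cnj (P $$ (x, i))) = complex_of_real (s i)"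
  by (simp add: s_def column_norm complex_norm_square[symmetric])

lemma s_pos:
  assumes i: "i < n"
  shows "0 < s i"
proof -
  have s: "s i = (\<Sum>x<n. (cmod (P $$ (x, i)))\<^sup>2)"
    using column_norm_real[OF i] by (simp add: complex_norm_square[symmetric] flip: of_real_power of_real_sum)
  have "s i \<noteq> 0"
  proof
    assume "s i = 0"
    then have "P $$ (x, i) = 0" if "x < n" for x
      using that by (simp add: s sum_nonneg_eq_0_iff)
    \<comment> \<open>A zero column of \<open>P\<close> contradicts the left inverse
      \<open>mat_adjoint V * mat_inv_sqrt \<sigma>\<close> of \<open>P\<close>.\<close>
    then have "(mat_adjoint V * mat_inv_sqrt \<sigma> * P) $$ (i, i) = 0"
      using i by (subst mult_mat_index[of _ n n _ n]) (auto simp: carr)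
    moreover have "mat_adjoint V * mat_inv_sqrt \<sigma> * P = 1\<^sub>m n"
      by (simp add: P_def assoc carr cancel \<sigma>_sqrt VV)
    ultimately show False using i by simp
  qed
  then show ?thesis using s by (simp add: sum_nonneg order.not_eq_order_implies_strict)
qed

text \<open>Used with three families \<open>c\<close>: the constant 1 and \<open>lam\<close> give
  the normalisation of the two distributions from the traces of \<open>\<sigma>\<close> and
  \<open>\<rho>\<close>, and \<open>f\<close> applied to \<open>lam\<close> gives the maximal
  divergence.\<close>

lemma trace_P_real_diag:
  "mat_trace (P * real_diag n c * mat_adjoint P) = complex_of_real (\<Sum>i<n. c i * s i)"
proof -
  have "mat_trace (P * real_diag n c * mat_adjoint P)
      = (\<Sum>x<n. \<Sum>i<n. complex_of_real (c i) * (P $$ (x, i) * cnj (P $$ (x, i))))"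
    using carrier_matD[OF carriers(4)]
    by (simp add: mat_trace_def real_diag_congruence_index[of _ n] del: index_mult_mat(1))
  also have "\<dots> = (\<Sum>i<n. \<Sum>x<n. complex_of_real (c i) * (P $$ (x, i) * cnj (P $$ (x, i))))"
    by (rule sum.swap)
  also have "\<dots> = complex_of_real (\<Sum>i<n. c i * s i)"
    by (simp add: sum_distrib_left[symmetric] column_norm_real)
  finally show ?thesis .
qed

lemma prob_dist_s: "prob_dist n s"
proof -
  have "complex_of_real (\<Sum>i<n. s i) = mat_trace \<sigma>"
    using trace_P_real_diag[of "\<lambda>_. 1"] unfolding P_one by simp
  then have "(\<Sum>i<n. s i) = 1" using \<sigma> by (simp add: quantum_state_def flip: of_real_sum)
  then show ?thesis using s_pos by (auto simp: prob_dist_def less_imp_le)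
qed

lemma prob_dist_r: "prob_dist n (\<lambda>i. lam i * s i)"
proof -
  have "complex_of_real (\<Sum>i<n. lam i * s i) = mat_trace \<rho>"
    using trace_P_real_diag[of lam] unfolding P_lam by simp
  then have "(\<Sum>i<n. lam i * s i) = 1"
    using \<rho> by (simp add: quantum_state_def flip: of_real_sum of_real_mult)
  then show ?thesis using s_pos lam_nonneg by (auto simp: prob_dist_def less_imp_le)
qed

lemma max_f_divergence_eq:
  "max_f_divergence f \<rho> \<sigma> = complex_of_real (\<Sum>i<n. f (lam i) * s i)"
  unfolding max_f_divergence_def S_def[symmetric] P_real_diag[symmetric] trace_P_real_diag ..

text \<open>As \<open>s\<close> is strictly positive, the branch with the limit never occurs and
  each ratio is \<open>lam i\<close>. The primed families have to agree with the canonical ones only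
  below \<open>n\<close>, as do those supplied in the theorem.\<close>

lemma classical_f_divergence_eq:
  assumes "\<And>i. i < n \<Longrightarrow> s' i = s i" "\<And>i. i < n \<Longrightarrow> r' i = lam i * s i"
  shows "classical_f_divergence f n r' s' = ereal (Re (max_f_divergence f \<rho> \<sigma>))"
proof -
  have "classical_f_divergence f n r' s' = (\<Sum>i<n. ereal (f (lam i) * s i))"
    unfolding classical_f_divergence_def
  proof (rule sum.cong)
    fix i assume "i \<in> {..<n}"
    then show "(if s' i = 0 then if r' i = 0 then 0 else ereal (r' i) * Lim at_top (\<lambda>x. ereal (f x / x))
        else ereal (s' i * f (r' i / s' i))) = ereal (f (lam i) * s i)"
      using s_pos[of i] assms[of i] by simp
  qed simp
  then show ?thesis by (simp add: max_f_divergence_eq)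
qed

lemma divergence_le_max:
  assumes D: "quantum_f_divergence f D"
  shows "D \<rho> \<sigma> \<le> ereal (Re (max_f_divergence f \<rho> \<sigma>))"
proof -
  \<comment> \<open>The weight \<open>1 / s i\<close> normalises column \<open>i\<close> of
    \<open>P\<close>, and it cancels the factor \<open>s i\<close> in both diagonal states.\<close>
  define W where "W = measure_prepare n n (\<lambda>i. 1 / s i) P"
  have W: "quantum_channel n n W"
    unfolding W_def
  proof (rule quantum_channel_measure_prepare)
    fix i assume i: "i < n"
    show "0 \<le> 1 / s i" using s_pos[OF i] by simp
    show "complex_of_real (1 / s i) * (\<Sum>x<n. P $$ (x, i) * cnj (P $$ (x, i))) = 1"
      using s_pos[OF i] by (simp add: column_norm_real[OF i] del: of_real_divide flip: of_real_mult)
  qed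
  have cong: "real_diag n a = real_diag n b" if "\<And>i. i < n \<Longrightarrow> a i = b i" for a b
    using that by (auto simp: real_diag_def intro!: cong_mat)
  have s0: "s i \<noteq> 0" if "i < n" for i using s_pos[OF that] by simp
  have "W (real_diag n s) = P * real_diag n (\<lambda>i. 1 / s i * s i) * mat_adjoint P"
    unfolding W_def by (rule measure_prepare_real_diag) simp
  also have "real_diag n (\<lambda>i. 1 / s i * s i) = real_diag n (\<lambda>_. 1)"
    by (rule cong) (simp add: s0)
  finally have W\<sigma>: "W (real_diag n s) = \<sigma>" by (simp only: P_one)
  have "W (real_diag n (\<lambda>i. lam i * s i)) = P * real_diag n (\<lambda>i. 1 / s i * (lam i * s i)) * mat_adjoint P"
    unfolding W_def by (rule measure_prepare_real_diag) simp
  also have "real_diag n (\<lambda>i. 1 / s i * (lam i * s i)) = real_diag n lam"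
    by (rule cong) (simp add: s0)
  finally have W\<rho>: "W (real_diag n (\<lambda>i. lam i * s i)) = \<rho>" by (simp only: P_lam)
  \<comment> \<open>Monotonicity under \<open>W\<close>, whose outputs are \<open>\<rho>\<close> and
    \<open>\<sigma>\<close>.\<close>
  have "D \<rho> \<sigma> \<le> D (real_diag n (\<lambda>i. lam i * s i)) (real_diag n s)"
    using D W quantum_state_real_diag[OF prob_dist_r] quantum_state_real_diag[OF prob_dist_s]
    unfolding quantum_f_divergence_def by (metis W\<rho> W\<sigma>)
  also have "\<dots> = ereal (Re (max_f_divergence f \<rho> \<sigma>))"
    by (simp add: quantum_f_divergence_real_diag[OF D prob_dist_r prob_dist_s] classical_f_divergence_eq)
  finally show ?thesis .
qed

end

theorem theorem1:
  fixes n :: nat and \<rho> \<sigma> :: "complex mat"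
  assumes "quantum_state n \<rho>" and "quantum_state n \<sigma>" and "invertible_mat \<sigma>"
  shows
    "(\<forall>f :: real \<Rightarrow> real. convex_on {0..} f \<and> f 1 = 0 \<longrightarrow>
        max_f_divergence f \<rho> \<sigma> \<in> \<real> \<and>
        (\<forall>D. quantum_f_divergence f D \<longrightarrow> D \<rho> \<sigma> \<le> ereal (Re (max_f_divergence f \<rho> \<sigma>))))
     \<and>
     (\<exists>r s. prob_dist n r \<and> prob_dist n s \<and>
        (\<forall>f :: real \<Rightarrow> real. convex_on {0..} f \<and> f 1 = 0 \<longrightarrow>
           ereal (Re (max_f_divergence f \<rho> \<sigma>)) = classical_f_divergence f n r s))
     \<and>
     (\<forall>lam u r s.
        spectral_decomposition n (mat_inv_sqrt \<sigma> * \<rho> * mat_inv_sqrt \<sigma>) lam u \<longrightarrow>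
        (\<forall>i<n. s i = Re ((\<sigma> *\<^sub>v u i) \<bullet>c u i) \<and> r i = lam i * s i) \<longrightarrow>
        (\<forall>i<n. 0 \<le> lam i \<and> complex_of_real (s i) = (\<sigma> *\<^sub>v u i) \<bullet>c u i \<and> 0 < s i \<and> 0 \<le> r i) \<and>
        prob_dist n r \<and> prob_dist n s \<and>
        (\<forall>f :: real \<Rightarrow> real. convex_on {0..} f \<and> f 1 = 0 \<longrightarrow>
           ereal (Re (max_f_divergence f \<rho> \<sigma>)) = classical_f_divergence f n r s))"
proof (intro conjI)
  have \<sigma>: "psd n \<sigma>" and \<rho>: "psd n \<rho>" using assms by (simp_all add: quantum_state_def)
  note sq = mat_sqrt_inv_sqrt[OF \<sigma> assms(3)]
  have "psd n (mat_inv_sqrt \<sigma> * \<rho> * mat_inv_sqrt \<sigma>)"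
    using psd_congruence[OF \<rho> sq(2)] by (simp add: sq)
  then obtain lam u where
    dec: "spectral_decomposition n (mat_inv_sqrt \<sigma> * \<rho> * mat_inv_sqrt \<sigma>) lam u"
    using hermitian_spectral_decomposition by (metis psd_def)
  interpret relative_spectral_decomposition n \<rho> \<sigma> lam u
    by unfold_locales (use assms dec in auto)
  show "\<forall>f :: real \<Rightarrow> real. convex_on {0..} f \<and> f 1 = 0 \<longrightarrow>
        max_f_divergence f \<rho> \<sigma> \<in> \<real> \<and>
        (\<forall>D. quantum_f_divergence f D \<longrightarrow> D \<rho> \<sigma> \<le> ereal (Re (max_f_divergence f \<rho> \<sigma>)))"
    using divergence_le_max by (simp add: max_f_divergence_eq)
  show "\<exists>r s. prob_dist n r \<and> prob_dist n s \<and>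
        (\<forall>f :: real \<Rightarrow> real. convex_on {0..} f \<and> f 1 = 0 \<longrightarrow>
           ereal (Re (max_f_divergence f \<rho> \<sigma>)) = classical_f_divergence f n r s)"
    \<comment> \<open>The witnesses are built from \<open>lam\<close> and \<open>s\<close> alone, so
      a single pair serves every \<open>f\<close>.\<close>
    using prob_dist_r prob_dist_s classical_f_divergence_eq[OF refl refl] by metis
next
  show "\<forall>lam u r s.
        spectral_decomposition n (mat_inv_sqrt \<sigma> * \<rho> * mat_inv_sqrt \<sigma>) lam u \<longrightarrow>
        (\<forall>i<n. s i = Re ((\<sigma> *\<^sub>v u i) \<bullet>c u i) \<and> r i = lam i * s i) \<longrightarrow>
        (\<forall>i<n. 0 \<le> lam i \<and> complex_of_real (s i) = (\<sigma> *\<^sub>v u i) \<bullet>c u i \<and> 0 < s i \<and> 0 \<le> r i) \<and>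
        prob_dist n r \<and> prob_dist n s \<and>
        (\<forall>f :: real \<Rightarrow> real. convex_on {0..} f \<and> f 1 = 0 \<longrightarrow>
           ereal (Re (max_f_divergence f \<rho> \<sigma>)) = classical_f_divergence f n r s)"
  proof (intro allI impI)
    fix lam r s :: "nat \<Rightarrow> real" and u
    assume dec: "spectral_decomposition n (mat_inv_sqrt \<sigma> * \<rho> * mat_inv_sqrt \<sigma>) lam u"
      and rs: "\<forall>i<n. s i = Re ((\<sigma> *\<^sub>v u i) \<bullet>c u i) \<and> r i = lam i * s i"
    \<comment> \<open>A second instance, now for the given decomposition instead of the one obtained
      from the spectral theorem.\<close>
    interpret R: relative_spectral_decomposition n \<rho> \<sigma> lam u
      by unfold_locales (use assms dec in auto)
    have s: "s i = R.s i" and r: "r i = lam i * R.s i" if "i < n" for i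
      using rs that by (simp_all add: R.s_def)
    have "prob_dist n r" "prob_dist n s"
      using R.prob_dist_r R.prob_dist_s by (simp_all add: prob_dist_def r s)
    moreover have "\<forall>i<n. 0 \<le> lam i \<and> complex_of_real (s i) = (\<sigma> *\<^sub>v u i) \<bullet>c u i \<and> 0 < s i \<and> 0 \<le> r i"
      using R.lam_nonneg R.s_pos R.column_norm R.column_norm_real by (simp add: r s less_imp_le)
    ultimately show "(\<forall>i<n. 0 \<le> lam i \<and> complex_of_real (s i) = (\<sigma> *\<^sub>v u i) \<bullet>c u i \<and> 0 < s i \<and> 0 \<le> r i) \<and>
        prob_dist n r \<and> prob_dist n s \<and>
        (\<forall>f :: real \<Rightarrow> real. convex_on {0..} f \<and> f 1 = 0 \<longrightarrow>
           ereal (Re (max_f_divergence f \<rho> \<sigma>)) = classical_f_divergence f n r s)"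
      using R.classical_f_divergence_eq[OF s r] by simp
  qed
qed

end
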